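(* Let $r,n$ be positive integers, let $A\in RI(r,n)$, let $m$ be a positive integer with $m\le n$, and set $t=\frac mn$, $\alpha=\frac tr$. Then $$\mathrm{per}_m(A)\ \ge\ SF(r,n,m):=\frac{(1-\alpha)^{(1-\alpha)nr}\,(1-n^{-1})^{(1-n^{-1})2n^2(1-t)}}{\alpha^{nt}\, n^{-2n(1-t)}\,\big((n(1-t))!\big)^2}.$$
   Context: $RI(r,n)$ is the set of $n\times n$ matrices with non-negative integer entries all of whose row and column sums equal $r$. For an $n\times n$ matrix $A$ and $1\le m\le n$, $\mathrm{per}_m(A)=\sum_{|S|=|T|=m}\mathrm{per}(A_{S,T})$, the sum of the permanents of all $m\times m$ submatrices $A_{S,T}$ (rows $S$, columns $T$). Convention $0^0=1$. *)

theory Defs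
  imports "HOL-Analysis.Analysis" "HOL-Library.FuncSet"
begin

text \<open>n x n matrices with non-negative integer entries are functions
  nat => nat => nat; only the entries with indices below n are relevant.\<close>

definition RI :: "nat \<Rightarrow> nat \<Rightarrow> (nat \<Rightarrow> nat \<Rightarrow> nat) \<Rightarrow> bool" where
  "RI r n A \<longleftrightarrow> (\<forall>i<n. (\<Sum>j<n. A i j) = r) \<and> (\<forall>j<n. (\<Sum>i<n. A i j) = r)"

definition per_sub :: "(nat \<Rightarrow> nat \<Rightarrow> nat) \<Rightarrow> nat set \<Rightarrow> nat set \<Rightarrow> nat" where
  "per_sub A S T = (\<Sum>f\<in>{f \<in> S \<rightarrow>\<^sub>E T. bij_betw f S T}. \<Prod>i\<in>S. A i (f i))"

definition per_m :: "nat \<Rightarrow> nat \<Rightarrow> (nat \<Rightarrow> nat \<Rightarrow> nat) \<Rightarrow> nat" where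
  "per_m n m A = (\<Sum>S\<in>{S. S \<subseteq> {..<n} \<and> card S = m}.
                    \<Sum>T\<in>{T. T \<subseteq> {..<n} \<and> card T = m}. per_sub A S T)"

definition pow0 :: "real \<Rightarrow> real \<Rightarrow> real" where
  "pow0 x y = (if x = 0 then (if y = 0 then 1 else 0) else x powr y)"

definition SF :: "nat \<Rightarrow> nat \<Rightarrow> nat \<Rightarrow> real" where
  "SF r n m = (let t = real m / real n; \<alpha> = t / real r in
     pow0 (1 - \<alpha>) ((1 - \<alpha>) * real n * real r)
     * pow0 (1 - 1 / real n) ((1 - 1 / real n) * 2 * (real n)^2 * (1 - t))
     / (pow0 \<alpha> (real n * t) * pow0 (real n) (- 2 * real n * (1 - t))
        * (fact (n - m))^2))"

end

theory Submission
  imports Defs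
begin

text \<open>
  Border \<open>\<alpha> A\<close> by \<open>k = n - m\<close> rows and columns with entries \<open>1/n\<close> (and a zero corner) to get a
  doubly stochastic matrix \<open>B\<close> with \<open>per B = \<alpha>^m n^(-2k) (k!)^2 per_m A\<close>. It remains to bound
  \<open>per B\<close> below by the Bethe product of the \<open>(1 - B i j) ^ (1 - B i j)\<close>.
  Multiple entries of \<open>A\<close> are absorbed by superadditivity of \<open>x \<mapsto> (1 - x) ln (1 - x)\<close>.

  For the Bethe bound, start from the product of the row forms \<open>\<Sum>j. B i j * x i j\<close> and the column
  forms \<open>\<Sum>i. B i j * y i j\<close>, which is at least the product of the \<open>(x i j * y i j) ^ B i j\<close> by
  AM-GM, and eliminate the variables \<open>x i j, y i j\<close> one edge at a time. At every stage the
  polynomial is a bipartite monomer-dimer partition function \<open>Z\<close>, whose dimers are the edges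
  already eliminated. An elimination costs only a factor \<open>(1 - B i j) ^ (1 - B i j)\<close> thanks to
  the correlation inequality \<open>Z (S - i, T) Z (S, T - j) \<le> Z (S, T) Z (S - i, T - j)\<close>.
\<close>

subsection \<open>Monomer-dimer partition functions of bipartite graphs\<close>

definition matchings :: "'a set \<Rightarrow> 'b set \<Rightarrow> ('a \<times> 'b) set set" where
  "matchings S T = {M. M \<subseteq> S \<times> T \<and> inj_on fst M \<and> inj_on snd M}"

text \<open>The monomer-dimer partition function: \<open>a\<close> weights the dimers,
  \<open>u\<close> and \<open>v\<close> weight the uncovered rows and columns. At
  \<open>u = v = 0\<close> only perfect matchings survive, which turns it into a permanent.\<close>

definition matching_poly ::
  "('a \<Rightarrow> 'b \<Rightarrow> real) \<Rightarrow> ('a \<Rightarrow> real) \<Rightarrow> ('b \<Rightarrow> real) \<Rightarrow> 'a set \<Rightarrow> 'b set \<Rightarrow> real" where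
  "matching_poly a u v S T = (\<Sum>M\<in>matchings S T.
     (\<Prod>(i,j)\<in>M. a i j) * (\<Prod>i\<in>S - fst ` M. u i) * (\<Prod>j\<in>T - snd ` M. v j))"

lemma finite_matchings: "finite S \<Longrightarrow> finite T \<Longrightarrow> finite (matchings S T)"
  by (rule finite_subset[of _ "Pow (S \<times> T)"]) (auto simp: matchings_def)

lemma matchings_finite: "M \<in> matchings S T \<Longrightarrow> finite S \<Longrightarrow> finite T \<Longrightarrow> finite M"
  by (auto simp: matchings_def intro: finite_subset[of M "S \<times> T"])

lemma matching_poly_cong:
  assumes "\<And>i j. i \<in> S \<Longrightarrow> j \<in> T \<Longrightarrow> a i j = a' i j"
    and "\<And>i. i \<in> S \<Longrightarrow> u i = u' i" and "\<And>j. j \<in> T \<Longrightarrow> v j = v' j"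
  shows "matching_poly a u v S T = matching_poly a' u' v' S T"
  unfolding matching_poly_def
proof (rule sum.cong[OF refl])
  fix M assume "M \<in> matchings S T"
  then have M: "M \<subseteq> S \<times> T" by (simp add: matchings_def)
  have "(\<Prod>(i,j)\<in>M. a i j) = (\<Prod>(i,j)\<in>M. a' i j)"
    using M assms(1) by (intro prod.cong) auto
  moreover have "(\<Prod>i\<in>S - fst ` M. u i) = (\<Prod>i\<in>S - fst ` M. u' i)"
    using assms(2) by (intro prod.cong) auto
  moreover have "(\<Prod>j\<in>T - snd ` M. v j) = (\<Prod>j\<in>T - snd ` M. v' j)"
    using assms(3) by (intro prod.cong) auto
  ultimately show "(\<Prod>(i,j)\<in>M. a i j) * (\<Prod>i\<in>S - fst ` M. u i) * (\<Prod>j\<in>T - snd ` M. v j)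
    = (\<Prod>(i,j)\<in>M. a' i j) * (\<Prod>i\<in>S - fst ` M. u' i) * (\<Prod>j\<in>T - snd ` M. v' j)"
    by simp
qed

lemma matchings_swap: "M \<in> matchings S T \<Longrightarrow> prod.swap ` M \<in> matchings T S"
  by (fastforce simp: matchings_def inj_on_def)

text \<open>Allows statements about rows to be proved once and carried over to columns.\<close>

lemma matching_poly_transpose: "matching_poly a u v S T = matching_poly (\<lambda>j i. a i j) v u T S"
  unfolding matching_poly_def
proof (rule sum.reindex_bij_witness[of _ "image prod.swap" "image prod.swap"])
  fix M assume "M \<in> matchings S T"
  then show "prod.swap ` M \<in> matchings T S"
    by (rule matchings_swap)
  have "(\<Prod>(j,i)\<in>prod.swap ` M. a i j) = (\<Prod>(i,j)\<in>M. a i j)"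
    by (subst prod.reindex) (auto simp: case_prod_unfold)
  then show "(\<Prod>(j,i)\<in>prod.swap ` M. a i j) * (\<Prod>j\<in>T - fst ` prod.swap ` M. v j)
      * (\<Prod>i\<in>S - snd ` prod.swap ` M. u i)
    = (\<Prod>(i,j)\<in>M. a i j) * (\<Prod>i\<in>S - fst ` M. u i) * (\<Prod>j\<in>T - snd ` M. v j)"
    by (simp add: image_image)
qed (auto simp: image_image matchings_swap)

text \<open>Row \<open>i\<close> is either uncovered or lies on exactly one dimer
  \<open>(i,j)\<close>; deleting that dimer leaves a matching that avoids both endpoints. This is
  the combinatorial form of the expansion along a row.\<close>

lemma matchings_split:
  assumes "i \<in> S"
  shows "matchings S T = matchings (S - {i}) T
    \<union> (\<Union>j\<in>T. insert (i,j) ` matchings (S - {i}) (T - {j}))" (is "?L = ?R")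
proof
  show "?L \<subseteq> ?R"
  proof
    fix M assume M: "M \<in> ?L"
    show "M \<in> ?R"
    proof (cases "i \<in> fst ` M")
      case False
      then have "M \<in> matchings (S - {i}) T"
        using M by (force simp: matchings_def)
      then show ?thesis by simp
    next
      case True
      then obtain j where j: "(i,j) \<in> M" by auto
      have M': "M \<subseteq> S \<times> T" "inj_on fst M" "inj_on snd M"
        using M by (auto simp: matchings_def)
      have "p \<in> (S - {i}) \<times> (T - {j})" if "p \<in> M" "p \<noteq> (i,j)" for p
      proof -
        have "fst p \<noteq> i" "snd p \<noteq> j"
          using that j inj_onD[OF M'(2), of p "(i,j)"] inj_onD[OF M'(3), of p "(i,j)"] by auto
        then show ?thesis using M'(1) that(1) by (auto simp: mem_Times_iff)
      qed
      then have "M - {(i,j)} \<subseteq> (S - {i}) \<times> (T - {j})" by blast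
      then have "M - {(i,j)} \<in> matchings (S - {i}) (T - {j})"
        using M' by (auto simp: matchings_def intro: inj_on_subset)
      moreover have "M = insert (i,j) (M - {(i,j)})" "j \<in> T" using j M' by auto
      ultimately show ?thesis by blast
    qed
  qed
  have "insert (i,j) N \<in> matchings S T"
    if "j \<in> T" and N: "N \<in> matchings (S - {i}) (T - {j})" for j N
  proof -
    have "N \<subseteq> (S - {i}) \<times> (T - {j})" "inj_on fst N" "inj_on snd N"
      using N by (auto simp: matchings_def)
    moreover from this have "i \<notin> fst ` N" "j \<notin> snd ` N" by auto
    ultimately show ?thesis using assms \<open>j \<in> T\<close> by (auto simp: matchings_def)
  qed
  moreover have "matchings (S - {i}) T \<subseteq> matchings S T"
    unfolding matchings_def by blast
  ultimately show "?R \<subseteq> ?L" by blast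
qed

lemma matching_poly_row:
  assumes "finite S" "finite T" "i \<in> S"
  shows "matching_poly a u v S T = u i * matching_poly a u v (S - {i}) T
    + (\<Sum>j\<in>T. a i j * matching_poly a u v (S - {i}) (T - {j}))"
proof -
  define w where "w M = (\<Prod>(i,j)\<in>M. a i j) * (\<Prod>i\<in>S - fst ` M. u i) * (\<Prod>j\<in>T - snd ` M. v j)"
    for M
  let ?N = "\<lambda>j. insert (i,j) ` matchings (S - {i}) (T - {j})"
  have fin: "finite (matchings (S - {i}) T)" "\<And>j. finite (?N j)"
    using assms by (auto intro!: finite_matchings)
  have notin: "(i,j) \<notin> M" if "M \<in> matchings (S - {i}) T'" for M j and T' :: "'b set"
    using that by (auto simp: matchings_def)
  have "matching_poly a u v S T = sum w (matchings (S - {i}) T \<union> (\<Union>j\<in>T. ?N j))"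
    unfolding matching_poly_def matchings_split[OF assms(3)] w_def ..
  also have "\<dots> = sum w (matchings (S - {i}) T) + sum w (\<Union>j\<in>T. ?N j)"
    using assms fin notin by (intro sum.union_disjoint) auto
  also have "sum w (\<Union>j\<in>T. ?N j) = (\<Sum>j\<in>T. sum w (?N j))"
  proof (rule sum.UNION_disjoint[OF assms(2)])
    show "\<forall>j\<in>T. \<forall>l\<in>T. j \<noteq> l \<longrightarrow> ?N j \<inter> ?N l = {}"
    proof (intro ballI impI)
      fix j l :: 'b assume "j \<noteq> l"
      show "?N j \<inter> ?N l = {}"
      proof (rule ccontr)
        assume "?N j \<inter> ?N l \<noteq> {}"
        then obtain M N where MN: "M \<in> matchings (S - {i}) (T - {j})"
          "N \<in> matchings (S - {i}) (T - {l})" "insert (i,j) M = insert (i,l) N" by auto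
        then have "(i,j) \<in> insert (i,l) N" by auto
        then have "(i,j) \<in> N" using \<open>j \<noteq> l\<close> by auto
        then show False using notin[OF MN(2)] by auto
      qed
    qed
  qed (use fin in auto)
  also have "sum w (matchings (S - {i}) T) = u i * matching_poly a u v (S - {i}) T"
    unfolding matching_poly_def sum_distrib_left
  proof (rule sum.cong[OF refl])
    fix M assume M: "M \<in> matchings (S - {i}) T"
    then have "S - fst ` M = insert i (S - {i} - fst ` M)"
      using assms by (auto simp: matchings_def)
    then have "(\<Prod>i\<in>S - fst ` M. u i) = u i * (\<Prod>i\<in>S - {i} - fst ` M. u i)"
      using assms by simp
    then show "w M = u i * ((\<Prod>(i,j)\<in>M. a i j) * (\<Prod>i\<in>S - {i} - fst ` M. u i)
        * (\<Prod>j\<in>T - snd ` M. v j))"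
      by (simp add: w_def)
  qed
  also have "(\<Sum>j\<in>T. sum w (?N j)) = (\<Sum>j\<in>T. a i j * matching_poly a u v (S - {i}) (T - {j}))"
  proof (rule sum.cong[OF refl])
    fix j assume "j \<in> T"
    have "inj_on (insert (i,j)) (matchings (S - {i}) (T - {j}))"
      using notin by (meson inj_onI insert_ident)
    then have "sum w (?N j) = (\<Sum>M\<in>matchings (S - {i}) (T - {j}). w (insert (i,j) M))"
      by (simp add: sum.reindex)
    also have "\<dots> = a i j * matching_poly a u v (S - {i}) (T - {j})"
      unfolding matching_poly_def sum_distrib_left
    proof (rule sum.cong[OF refl])
      fix M assume M: "M \<in> matchings (S - {i}) (T - {j})"
      then have "finite M" using assms matchings_finite by (metis finite_Diff)
      then have "(\<Prod>(i,j)\<in>insert (i,j) M. a i j) = a i j * (\<Prod>(i,j)\<in>M. a i j)"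
        using notin[OF M] by simp
      moreover have "S - fst ` insert (i,j) M = S - {i} - fst ` M"
        "T - snd ` insert (i,j) M = T - {j} - snd ` M" by auto
      ultimately show "w (insert (i,j) M) = a i j * ((\<Prod>(i,j)\<in>M. a i j)
        * (\<Prod>i\<in>S - {i} - fst ` M. u i) * (\<Prod>j\<in>T - {j} - snd ` M. v j))"
        by (simp add: w_def)
    qed
    finally show "sum w (?N j) = a i j * matching_poly a u v (S - {i}) (T - {j})" .
  qed
  finally show ?thesis .
qed

lemma matching_poly_col:
  assumes "finite S" "finite T" "j \<in> T"
  shows "matching_poly a u v S T = v j * matching_poly a u v S (T - {j})
    + (\<Sum>i\<in>S. a i j * matching_poly a u v (S - {i}) (T - {j}))"
  using matching_poly_row[OF assms(2,1,3), of "\<lambda>j i. a i j" v u]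
  by (simp flip: matching_poly_transpose[of a u v])

lemma matching_poly_no_rows:
  fixes a :: "'a \<Rightarrow> 'b \<Rightarrow> real"
  shows "matching_poly a u v {} T = (\<Prod>j\<in>T. v j)"
proof -
  have "matchings ({} :: 'a set) T = {{}}" by (auto simp: matchings_def)
  then show ?thesis unfolding matching_poly_def by simp
qed

text \<open>The empty matching already contributes a positive term. Strictness matters because the
  elimination step divides by such values.\<close>

lemma matching_poly_pos:
  assumes "finite S" "finite T" "\<And>i j. i \<in> S \<Longrightarrow> j \<in> T \<Longrightarrow> 0 \<le> a i j"
    and "\<And>i. i \<in> S \<Longrightarrow> 0 < u i" and "\<And>j. j \<in> T \<Longrightarrow> 0 < v j"
  shows "0 < matching_poly a u v S T"
  using assms
proof (induction S arbitrary: T rule: finite_induct)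
  case empty
  then show ?case by (simp add: matching_poly_no_rows prod_pos)
next
  case (insert i S)
  have "0 < matching_poly a u v S T" using insert by auto
  moreover have "0 \<le> a i j * matching_poly a u v S (T - {j})" if "j \<in> T" for j
  proof (rule mult_nonneg_nonneg)
    show "0 \<le> a i j" using that insert.prems by auto
    show "0 \<le> matching_poly a u v S (T - {j})"
      using insert.prems by (intro less_imp_le[OF insert.IH]) auto
  qed
  ultimately show ?case
    using insert.prems insert.hyps
    by (subst matching_poly_row[of _ _ i]) (auto intro!: add_pos_nonneg sum_nonneg)
qed

text \<open>The two inequalities (row against column, column against column) are proved together by
  induction on the number of vertices: expanding the first along row \<open>i\<close> leaves
  instances of the second with one row fewer, and expanding the second along column \<open>j\<close>
  leaves instances of the first with one column fewer.\<close>

lemma matching_poly_correlation: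
  fixes a :: "'a \<Rightarrow> 'b \<Rightarrow> real"
  assumes "finite S" "finite T" and pos: "\<And>i j. 0 \<le> a i j"
  shows "i \<in> S \<Longrightarrow> j \<in> T \<Longrightarrow>
      matching_poly a u v (S - {i}) T * matching_poly a u v S (T - {j})
        \<le> matching_poly a u v S T * matching_poly a u v (S - {i}) (T - {j})"
    and "j \<in> T \<Longrightarrow> l \<in> T \<Longrightarrow> j \<noteq> l \<Longrightarrow>
      matching_poly a u v S T * matching_poly a u v S (T - {j} - {l})
        \<le> matching_poly a u v S (T - {j}) * matching_poly a u v S (T - {l})"
  using assms(1,2)
proof (induction "card S + card T" arbitrary: S T i j l rule: less_induct)
  case less
  let ?Z = "matching_poly a u v"
  {
    case 1
    have "?Z S T * ?Z (S - {i}) (T - {j}) - ?Z (S - {i}) T * ?Z S (T - {j})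
      = (\<Sum>l\<in>T. a i l * ?Z (S - {i}) (T - {l})) * ?Z (S - {i}) (T - {j})
        - ?Z (S - {i}) T * (\<Sum>l\<in>T - {j}. a i l * ?Z (S - {i}) (T - {j} - {l}))"
      using 1 by (simp add: matching_poly_row[of S _ i] algebra_simps)
    \<comment> \<open>The \<open>u i\<close> terms have cancelled. The summand \<open>l = j\<close>
      has no partner in the second sum and yields the square; every other bracket is a column-column
      inequality on \<open>S - {i}\<close>.\<close>
    also have "\<dots> = a i j * (?Z (S - {i}) (T - {j}))\<^sup>2 + (\<Sum>l\<in>T - {j}. a i l *
      (?Z (S - {i}) (T - {j}) * ?Z (S - {i}) (T - {l})
       - ?Z (S - {i}) T * ?Z (S - {i}) (T - {j} - {l})))"
      using 1 by (simp add: sum.remove[of T j] algebra_simps power2_eq_square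
          sum_distrib_left sum_subtractf)
    also have "\<dots> \<ge> 0"
    proof (intro add_nonneg_nonneg sum_nonneg mult_nonneg_nonneg pos zero_le_power2)
      fix l assume l: "l \<in> T - {j}"
      have "card (S - {i}) + card T < card S + card T"
        using 1 by (simp add: card_Diff1_less del: card_Diff_insert card_Diff_singleton)
      then have "?Z (S - {i}) T * ?Z (S - {i}) (T - {j} - {l})
        \<le> ?Z (S - {i}) (T - {j}) * ?Z (S - {i}) (T - {l})"
        by (rule less(2)) (use l 1 in auto)
      then show "0 \<le> ?Z (S - {i}) (T - {j}) * ?Z (S - {i}) (T - {l})
       - ?Z (S - {i}) T * ?Z (S - {i}) (T - {j} - {l})" by linarith
    qed
    finally show ?case by simp
  next
    case 2
    \<comment> \<open>Only the two factors that still contain column \<open>j\<close> are expanded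
      along it; their \<open>v j\<close> terms cancel.\<close>
    have "?Z S (T - {j}) * ?Z S (T - {l}) - ?Z S T * ?Z S (T - {j} - {l})
      = (\<Sum>i\<in>S. a i j * (?Z S (T - {j}) * ?Z (S - {i}) (T - {j} - {l})
          - ?Z (S - {i}) (T - {j}) * ?Z S (T - {j} - {l})))"
    proof -
      have "T - {l} - {j} = T - {j} - {l}" by auto
      then have l: "?Z S (T - {l}) = v j * ?Z S (T - {j} - {l})
        + (\<Sum>i\<in>S. a i j * ?Z (S - {i}) (T - {j} - {l}))"
        using 2 matching_poly_col[of S "T - {l}" j a u v] by simp
      have T: "?Z S T = v j * ?Z S (T - {j}) + (\<Sum>i\<in>S. a i j * ?Z (S - {i}) (T - {j}))"
        using 2 by (intro matching_poly_col)
      show ?thesis unfolding l T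
        by (simp add: algebra_simps sum_distrib_left sum_subtractf)
    qed
    also have "\<dots> \<ge> 0"
    proof (intro sum_nonneg mult_nonneg_nonneg pos)
      fix i assume i: "i \<in> S"
      have "card S + card (T - {j}) < card S + card T"
        using 2 by (simp add: card_Diff1_less del: card_Diff_insert card_Diff_singleton)
      then have "?Z (S - {i}) (T - {j}) * ?Z S (T - {j} - {l})
        \<le> ?Z S (T - {j}) * ?Z (S - {i}) (T - {j} - {l})"
        by (rule less(1)) (use i 2 in auto)
      then show "0 \<le> ?Z S (T - {j}) * ?Z (S - {i}) (T - {j} - {l})
          - ?Z (S - {i}) (T - {j}) * ?Z S (T - {j} - {l})" by linarith
    qed
    finally show ?case by simp
  }
qed

subsection \<open>The Bethe lower bound for permanents of doubly stochastic matrices\<close>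

text \<open>Jensen's inequality for the concave function \<open>ln\<close>, exponentiated.\<close>

lemma weighted_am_gm:
  fixes c x :: "'a \<Rightarrow> real"
  assumes "finite T" "sum c T = 1" and c: "\<And>j. j \<in> T \<Longrightarrow> 0 \<le> c j"
    and x: "\<And>j. j \<in> T \<Longrightarrow> 0 < x j"
  shows "(\<Prod>j\<in>T. x j powr c j) \<le> (\<Sum>j\<in>T. c j * x j)"
proof -
  have "T \<noteq> {}" using assms by auto
  then have "(\<Sum>j\<in>T. c j * ln (x j)) \<le> ln (\<Sum>j\<in>T. c j *\<^sub>R x j)"
    using assms by (intro concave_on_sum[OF _ _ ln_concave]) auto
  \<comment> \<open>Weights may vanish, but they sum to 1, so some weight is positive; this makes
    exponentiating the logarithmic bound legitimate.\<close>
  moreover have "0 < (\<Sum>j\<in>T. c j * x j)"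
  proof -
    obtain k where k: "k \<in> T" "c k \<noteq> 0"
      using assms(2) by (metis sum.neutral zero_neq_one)
    then have "0 < c k * x k" using c[of k] x[of k] by simp
    moreover have "\<forall>j\<in>T. 0 \<le> c j * x j"
      using c x by (simp add: less_imp_le)
    ultimately show ?thesis
      using k assms(1) by (intro sum_pos2[of T k]) auto
  qed
  ultimately have "exp (\<Sum>j\<in>T. c j * ln (x j)) \<le> (\<Sum>j\<in>T. c j * x j)"
    by (simp add: ln_ge_iff)
  moreover have "(\<Prod>j\<in>T. x j powr c j) = exp (\<Sum>j\<in>T. c j * ln (x j))"
    unfolding exp_sum[OF assms(1)]
  proof (rule prod.cong[OF refl])
    fix j assume "j \<in> T"
    then show "x j powr c j = exp (c j * ln (x j))" using x[of j] by (simp add: powr_def)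
  qed
  ultimately show ?thesis by simp
qed

text \<open>The cost of eliminating one edge \<open>(i,j)\<close>. Here \<open>P\<close>,
  \<open>Q\<close>, \<open>R\<close>, \<open>D\<close> stand for the partition function with both
  endpoints present, without \<open>i\<close>, without \<open>j\<close>, and without both;
  \<open>x\<close> and \<open>y\<close> are the two variables of the edge. The hypothesis
  \<open>bound\<close> is bilinear in them, and the conclusion is about the function in which the
  edge has become a dimer of weight \<open>a\<close>.\<close>

lemma bethe_step:
  fixes P Q R D a K :: real
  assumes pos: "0 < P" "0 < Q" "0 < R" "0 < D" and corr: "Q * R \<le> P * D"
    and a: "0 \<le> a" "a \<le> 1"
    and bound: "\<And>x y. 0 < x \<Longrightarrow> 0 < y \<Longrightarrow>
      K * (x * y) powr a \<le> P + a * x * Q + a * y * R + a * x * (a * y) * D"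
  shows "K * pow0 (1 - a) (1 - a) \<le> P + a * D"
proof -
  consider "a = 0" | "a = 1" | "0 < a" "a < 1" using a by linarith
  then show ?thesis
  proof cases
    case 1
    then show ?thesis using bound[of 1 1] by (simp add: pow0_def)
  next
    case 2
    \<comment> \<open>Compare the quadratic coefficients along \<open>x = y\<close> as it grows. The
      witness \<open>x\<close> exceeds 1 and is large enough that \<open>(K - D) * x\<close> beats
      \<open>P + Q + R\<close>.\<close>
    have "K \<le> D"
    proof (rule ccontr)
      assume "\<not> K \<le> D"
      define x where "x = (P + Q + R) / (K - D) + 1"
      have x: "1 < x" using \<open>\<not> K \<le> D\<close> pos by (simp add: x_def)
      have "(K - D) * x = P + Q + R + (K - D)"
        using \<open>\<not> K \<le> D\<close> by (simp add: x_def field_simps)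
      then have "(P + Q + R) * x < (K - D) * x * x"
        using x \<open>\<not> K \<le> D\<close> by (intro mult_strict_right_mono) auto
      moreover have "P * 1 \<le> P * x" using x pos by (intro mult_left_mono) auto
      moreover have "K * (x * x) \<le> P + x * Q + x * R + x * x * D"
        using bound[of x x] 2 x by simp
      ultimately show False by (simp add: algebra_simps)
    qed
    then show ?thesis using 2 pos by (simp add: pow0_def)
  next
    case 3
    \<comment> \<open>The optimal \<open>x, y\<close> have \<open>x * Q = y * R\<close>, which turns the bound at \<open>x * y = s\<^sup>2\<close> into
      \<open>K * s powr (2 * a) \<le> (sqrt P + a * s * sqrt D)\<^sup>2\<close>; then \<open>s\<close> balances the two terms.\<close>
    define w where "w = sqrt P / (1 - a)"
    define s where "s = w / sqrt D"
    define p where "p = P / (1 - a)"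
    have wp: "0 < w" "0 < s" "0 < p" using 3 pos by (auto simp: w_def s_def p_def)
    let ?x = "s * sqrt (R / Q)" and ?y = "s * sqrt (Q / R)"
    have xy: "?x * ?y = s\<^sup>2"
    proof -
      have "sqrt (R / Q) * sqrt (Q / R) = 1"
        using pos by (simp flip: real_sqrt_mult)
      then show ?thesis by (simp add: power2_eq_square algebra_simps)
    qed
    have xQ: "?x * Q = s * sqrt (Q * R)" "?y * R = s * sqrt (Q * R)"
      using pos by (auto simp: real_sqrt_divide real_sqrt_mult field_simps)
    have "K * (s\<^sup>2) powr a \<le> P + a * (?x * Q) + a * (?y * R) + a * a * (?x * ?y) * D"
      using bound[of ?x ?y] wp pos xy by (simp add: algebra_simps)
    also have "\<dots> = P + 2 * (a * s) * sqrt (Q * R) + (a * s)\<^sup>2 * D"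
      unfolding xy xQ by (simp add: algebra_simps power2_eq_square)
    also have "\<dots> \<le> P + 2 * (a * s) * sqrt (P * D) + (a * s)\<^sup>2 * D"
      using corr wp 3 by (intro add_mono mult_left_mono) auto
    also have "\<dots> = (sqrt P + a * (s * sqrt D))\<^sup>2"
      using pos by (simp add: power2_sum power_mult_distrib real_sqrt_mult algebra_simps)
    also have "sqrt P + a * (s * sqrt D) = w"
      using 3 pos by (simp add: s_def w_def field_simps)
    also have "w\<^sup>2 = p / (1 - a)"
      using pos 3 by (simp add: w_def p_def power_divide power2_eq_square)
    also have "s\<^sup>2 = p / ((1 - a) * D)"
      using pos 3 by (simp add: s_def w_def p_def power_divide power2_eq_square)
    finally have key: "K * (p / ((1 - a) * D)) powr a \<le> p / (1 - a)" .
    \<comment> \<open>It remains to solve \<open>key\<close> for \<open>K\<close>: multiplying it by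
      \<open>(1 - a) * D powr a * p powr (- a)\<close> gives \<open>K * (1 - a) powr (1 - a)\<close>
      on the left and \<open>p powr (1 - a) * D powr a\<close> on the right. Young's inequality
      bounds the latter by \<open>(1 - a) * p + a * D\<close>, and \<open>p\<close> was chosen so
      that \<open>(1 - a) * p = P\<close>.\<close>
    define b where "b = 1 - a"
    have b: "0 < b" using 3 by (simp add: b_def)
    have b1: "b powr (1 - a) = b / b powr a" using b by (simp add: powr_diff)
    have b2: "(p / (b * D)) powr a = p powr a / (b powr a * D powr a)"
      using wp pos b by (simp add: powr_divide powr_mult)
    have "K * b powr (1 - a) = K * (p / (b * D)) powr a * (b * (D powr a * p powr (- a)))"
      using wp pos b by (simp only: b1 b2 powr_minus) (simp add: divide_simps)
    then have "K * (1 - a) powr (1 - a)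
      = K * (p / ((1 - a) * D)) powr a * ((1 - a) * (D powr a * p powr (- a)))"
      by (simp only: b_def)
    also have "\<dots> \<le> p / (1 - a) * ((1 - a) * (D powr a * p powr (- a)))"
      using key 3 by (intro mult_right_mono) auto
    also have "\<dots> = p powr (1 - a) * D powr a"
      using wp 3 by (simp add: powr_diff powr_minus field_simps)
    also have "\<dots> \<le> (1 - a) * p + a * D"
      using 3 wp pos by (intro Youngs_inequality_0) auto
    also have "(1 - a) * p = P" using 3 by (simp add: p_def)
    finally show ?thesis using 3 by (simp add: pow0_def)
  qed
qed

text \<open>The partition function is affine in every single weight, and the slope is the partition
  function with the vertices of that weight deleted. The two lemmas that follow treat monomer
  weights in the same way.\<close>

lemma matching_poly_weight_update:
  assumes "finite S" "finite T" "i \<in> S" "j \<in> T"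
  shows "matching_poly (\<lambda>k l. if k = i \<and> l = j then a i j + c else a k l) u v S T
    = matching_poly a u v S T + c * matching_poly a u v (S - {i}) (T - {j})"
proof -
  let ?a = "\<lambda>k l. if k = i \<and> l = j then a i j + c else a k l"
  have eq: "matching_poly ?a u v (S - {i}) T' = matching_poly a u v (S - {i}) T'" for T'
    by (rule matching_poly_cong) auto
  show ?thesis
    unfolding matching_poly_row[OF assms(1-3), of ?a] matching_poly_row[OF assms(1-3), of a] eq
    using assms by (simp add: sum.remove[of T j] algebra_simps)
qed

lemma matching_poly_row_update:
  assumes "finite S" "finite T" "i \<in> S"
  shows "matching_poly a (u(i := u i + p)) v S T = matching_poly a u v S T + p * matching_poly a u v (S - {i}) T"
proof -
  have eq: "matching_poly a (u(i := u i + p)) v (S - {i}) T' = matching_poly a u v (S - {i}) T'" for T'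
    by (rule matching_poly_cong) auto
  show ?thesis
    unfolding matching_poly_row[OF assms] eq by (simp add: algebra_simps)
qed

lemma matching_poly_col_update:
  assumes "finite S" "finite T" "j \<in> T"
  shows "matching_poly a u (v(j := v j + q)) S T = matching_poly a u v S T + q * matching_poly a u v S (T - {j})"
  using matching_poly_row_update[OF assms(2,1,3), of "\<lambda>j i. a i j" v q u]
  by (simp flip: matching_poly_transpose[of a u])

lemma matching_poly_no_edges:
  assumes "finite S" "finite T"
  shows "matching_poly (\<lambda>i j. 0) u v S T = (\<Prod>i\<in>S. u i) * (\<Prod>j\<in>T. v j)"
  using assms(1)
proof induction
  case empty
  then show ?case by (simp add: matching_poly_no_rows)
next
  case (insert i S)
  then show ?case using assms(2) by (subst matching_poly_row[of _ _ i]) auto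
qed

text \<open>The invariant of the elimination, with \<open>E\<close> the set of edges already turned
  into dimers. It is stated for all positive \<open>x\<close> and \<open>y\<close> because the
  induction step must vary their values at the edge being eliminated. The term
  \<open>\<epsilon>\<close> keeps monomer weights positive even at a vertex whose edges are all
  eliminated.\<close>

lemma matching_poly_bethe_partial:
  fixes a :: "'a \<Rightarrow> 'b \<Rightarrow> real" and x y :: "'a \<times> 'b \<Rightarrow> real"
  assumes fin: "finite S" "finite T"
    and a: "\<And>i j. i \<in> S \<Longrightarrow> j \<in> T \<Longrightarrow> 0 \<le> a i j"
    and row: "\<And>i. i \<in> S \<Longrightarrow> (\<Sum>j\<in>T. a i j) = 1"
    and col: "\<And>j. j \<in> T \<Longrightarrow> (\<Sum>i\<in>S. a i j) = 1"
    and "0 < \<epsilon>" and "finite E" and "E \<subseteq> S \<times> T"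
    and "\<And>e. 0 < x e" and "\<And>e. 0 < y e"
  shows "(\<Prod>e\<in>S \<times> T - E. (x e * y e) powr case_prod a e)
      * (\<Prod>(i,j)\<in>E. pow0 (1 - a i j) (1 - a i j))
    \<le> matching_poly (\<lambda>i j. if (i,j) \<in> E then a i j else 0)
        (\<lambda>i. \<epsilon> + (\<Sum>j\<in>T. if (i,j) \<in> E then 0 else a i j * x (i,j)))
        (\<lambda>j. \<epsilon> + (\<Sum>i\<in>S. if (i,j) \<in> E then 0 else a i j * y (i,j))) S T"
  using assms(7-10)
proof (induction E arbitrary: x y rule: finite_induct)
  case empty
  have "(\<Prod>e\<in>S \<times> T. (x e * y e) powr case_prod a e)
    = (\<Prod>e\<in>S \<times> T. x e powr case_prod a e) * (\<Prod>e\<in>S \<times> T. y e powr case_prod a e)"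
    using empty by (simp add: powr_mult prod.distrib)
  also have "(\<Prod>e\<in>S \<times> T. x e powr case_prod a e) = (\<Prod>i\<in>S. \<Prod>j\<in>T. x (i,j) powr a i j)"
    by (subst prod.cartesian_product) (simp add: case_prod_unfold)
  also have "(\<Prod>e\<in>S \<times> T. y e powr case_prod a e) = (\<Prod>i\<in>S. \<Prod>j\<in>T. y (i,j) powr a i j)"
    by (subst prod.cartesian_product) (simp add: case_prod_unfold)
  also have "\<dots> = (\<Prod>j\<in>T. \<Prod>i\<in>S. y (i,j) powr a i j)"
    by (rule prod.swap)
  \<comment> \<open>Each row and each column of \<open>a\<close> is a probability vector, so
    weighted AM-GM applies factor by factor; adding \<open>\<epsilon>\<close> only enlarges the
    right side.\<close>
  also have "(\<Prod>i\<in>S. \<Prod>j\<in>T. x (i,j) powr a i j) * \<dots>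
    \<le> (\<Prod>i\<in>S. \<epsilon> + (\<Sum>j\<in>T. a i j * x (i,j))) * (\<Prod>j\<in>T. \<epsilon> + (\<Sum>i\<in>S. a i j * y (i,j)))"
  proof (intro mult_mono prod_mono conjI prod_nonneg)
    fix i assume "i \<in> S"
    then show "(\<Prod>j\<in>T. x (i,j) powr a i j) \<le> \<epsilon> + (\<Sum>j\<in>T. a i j * x (i,j))"
      using weighted_am_gm[of T "a i" "\<lambda>j. x (i,j)"] fin a row empty \<open>0 < \<epsilon>\<close> by simp
  next
    fix j assume "j \<in> T"
    then show "(\<Prod>i\<in>S. y (i,j) powr a i j) \<le> \<epsilon> + (\<Sum>i\<in>S. a i j * y (i,j))"
      using weighted_am_gm[of S "\<lambda>i. a i j" "\<lambda>i. y (i,j)"] fin a col empty \<open>0 < \<epsilon>\<close> by simp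
  next
    fix i assume "i \<in> S"
    then show "0 \<le> \<epsilon> + (\<Sum>j\<in>T. a i j * x (i,j))"
      using a empty \<open>0 < \<epsilon>\<close>
      by (intro add_nonneg_nonneg sum_nonneg mult_nonneg_nonneg a) (simp_all add: order_less_imp_le)
  qed (auto intro: prod_nonneg)
  finally show ?case by (simp add: matching_poly_no_edges fin)
next
  case (insert e E)
  obtain i j where e: "e = (i,j)" "i \<in> S" "j \<in> T" using insert.prems by auto
  have E: "E \<subseteq> S \<times> T" using insert.prems by simp
  let ?E = "insert e E"
  \<comment> \<open>An intermediate state: \<open>w\<close> does not yet contain \<open>e\<close> as
    a dimer, while \<open>u\<close> and \<open>v\<close> no longer contain its variables. The values
    \<open>P\<close>, \<open>Q\<close>, \<open>R\<close>, \<open>D\<close> of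
    \<open>bethe_step\<close> are taken at these weights.\<close>
  define w where "w k l = (if (k,l) \<in> E then a k l else 0)" for k l
  define u where "u k = \<epsilon> + (\<Sum>l\<in>T. if (k,l) \<in> ?E then 0 else a k l * x (k,l))" for k
  define v where "v l = \<epsilon> + (\<Sum>k\<in>S. if (k,l) \<in> ?E then 0 else a k l * y (k,l))" for l
  have w: "0 \<le> w k l" for k l using a E by (auto simp: w_def)
  have u: "0 < u k" if "k \<in> S" for k
    unfolding u_def using that a insert.prems \<open>0 < \<epsilon>\<close>
    by (intro add_pos_nonneg sum_nonneg) (simp_all add: order_less_imp_le)
  have v: "0 < v l" if "l \<in> T" for l
    unfolding v_def using that a insert.prems \<open>0 < \<epsilon>\<close>
    by (intro add_pos_nonneg sum_nonneg) (simp_all add: order_less_imp_le)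
  have pos: "0 < matching_poly w u v S' T'" if "S' \<subseteq> S" "T' \<subseteq> T" for S' T'
    using that fin u v w by (intro matching_poly_pos) (auto intro: finite_subset)
  \<comment> \<open>All factors of the lower bound that do not involve \<open>e\<close>.\<close>
  define K where "K = (\<Prod>e\<in>S \<times> T - ?E. (x e * y e) powr case_prod a e)
      * (\<Prod>(i,j)\<in>E. pow0 (1 - a i j) (1 - a i j))"
  have "K * pow0 (1 - a i j) (1 - a i j)
    \<le> matching_poly w u v S T + a i j * matching_poly w u v (S - {i}) (T - {j})"
  proof (rule bethe_step)
    show "matching_poly w u v (S - {i}) T * matching_poly w u v S (T - {j})
        \<le> matching_poly w u v S T * matching_poly w u v (S - {i}) (T - {j})"
      using fin w e by (intro matching_poly_correlation)
    have "a i j \<le> (\<Sum>l\<in>T. a i l)"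
      using e a fin by (intro member_le_sum) auto
    then show "a i j \<le> 1" using row e by simp
    show "0 \<le> a i j" using a e by simp
    \<comment> \<open>The hypothesis \<open>bound\<close> of \<open>bethe_step\<close> is the
      induction hypothesis with the values of \<open>x\<close> and \<open>y\<close> at
      \<open>e\<close> replaced by \<open>X\<close> and \<open>Y\<close>.\<close>
    fix X Y :: real assume XY: "0 < X" "0 < Y"
    let ?h = "\<lambda>e'. ((x(e := X)) e' * (y(e := Y)) e') powr case_prod a e'"
    have "prod ?h (S \<times> T - E) = ?h e * prod ?h (S \<times> T - E - {e})"
      using fin e insert.hyps by (intro prod.remove) simp_all
    also have "S \<times> T - E - {e} = S \<times> T - ?E" by blast
    also have "?h e = (X * Y) powr a i j" using e(1) by simp
    also have "(\<Prod>e'\<in>S \<times> T - ?E. ((x(e := X)) e' * (y(e := Y)) e') powr case_prod a e')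
      = (\<Prod>e\<in>S \<times> T - ?E. (x e * y e) powr case_prod a e)"
      by (rule prod.cong) simp_all
    finally have "K * (X * Y) powr a i j
      = (\<Prod>e'\<in>S \<times> T - E. ((x(e := X)) e' * (y(e := Y)) e') powr case_prod a e')
        * (\<Prod>(i,j)\<in>E. pow0 (1 - a i j) (1 - a i j))"
      by (simp add: K_def)
    also have "\<dots> \<le> matching_poly w
        (\<lambda>k. \<epsilon> + (\<Sum>l\<in>T. if (k,l) \<in> E then 0 else a k l * (x(e := X)) (k,l)))
        (\<lambda>l. \<epsilon> + (\<Sum>k\<in>S. if (k,l) \<in> E then 0 else a k l * (y(e := Y)) (k,l))) S T"
      unfolding w_def using insert.prems XY E by (intro insert.IH) simp_all
    also have "\<dots> = matching_poly w (u(i := u i + a i j * X)) (v(j := v j + a i j * Y)) S T"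
    proof (rule matching_poly_cong)
      fix k
      have "(\<Sum>l\<in>T. if (i,l) \<in> E then 0 else a i l * (x(e := X)) (i,l))
        = a i j * X + (\<Sum>l\<in>T. if (i,l) \<in> ?E then 0 else a i l * x (i,l))"
      proof -
        have "(\<Sum>l\<in>T - {j}. if (i,l) \<in> E then 0 else a i l * (x(e := X)) (i,l))
          = (\<Sum>l\<in>T - {j}. if (i,l) \<in> ?E then 0 else a i l * x (i,l))"
          using e(1) by (intro sum.cong) simp_all
        then show ?thesis
          unfolding sum.remove[OF fin(2) e(3)] using insert.hyps e(1) by simp
      qed
      moreover have "(\<Sum>l\<in>T. if (k,l) \<in> E then 0 else a k l * (x(e := X)) (k,l))
        = (\<Sum>l\<in>T. if (k,l) \<in> ?E then 0 else a k l * x (k,l))" if "k \<noteq> i"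
        using that e by (intro sum.cong) auto
      ultimately show "\<epsilon> + (\<Sum>l\<in>T. if (k,l) \<in> E then 0 else a k l * (x(e := X)) (k,l))
        = (u(i := u i + a i j * X)) k"
        by (cases "k = i") (simp_all add: u_def cong: if_cong)
    next
      fix l
      have "(\<Sum>k\<in>S. if (k,j) \<in> E then 0 else a k j * (y(e := Y)) (k,j))
        = a i j * Y + (\<Sum>k\<in>S. if (k,j) \<in> ?E then 0 else a k j * y (k,j))"
      proof -
        have "(\<Sum>k\<in>S - {i}. if (k,j) \<in> E then 0 else a k j * (y(e := Y)) (k,j))
          = (\<Sum>k\<in>S - {i}. if (k,j) \<in> ?E then 0 else a k j * y (k,j))"
          using e(1) by (intro sum.cong) simp_all
        then show ?thesis
          unfolding sum.remove[OF fin(1) e(2)] using insert.hyps e(1) by simp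
      qed
      moreover have "(\<Sum>k\<in>S. if (k,l) \<in> E then 0 else a k l * (y(e := Y)) (k,l))
        = (\<Sum>k\<in>S. if (k,l) \<in> ?E then 0 else a k l * y (k,l))" if "l \<noteq> j"
        using that e by (intro sum.cong) auto
      ultimately show "\<epsilon> + (\<Sum>k\<in>S. if (k,l) \<in> E then 0 else a k l * (y(e := Y)) (k,l))
        = (v(j := v j + a i j * Y)) l"
        by (cases "l = j") (simp_all add: v_def cong: if_cong)
    qed simp
    \<comment> \<open>The variables of \<open>e\<close> enter only the monomer weights of row
      \<open>i\<close> and column \<open>j\<close>, so the polynomial is bilinear in
      \<open>X\<close> and \<open>Y\<close>.\<close>
    also have "\<dots> = matching_poly w u v S T + a i j * X * matching_poly w u v (S - {i}) T
      + a i j * Y * matching_poly w u v S (T - {j})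
      + a i j * X * (a i j * Y) * matching_poly w u v (S - {i}) (T - {j})"
      unfolding matching_poly_col_update[OF fin e(3)] matching_poly_row_update[OF fin e(2)]
        matching_poly_row_update[OF fin(1) finite_Diff[OF fin(2)] e(2)]
      by (simp add: algebra_simps)
    finally show "K * (X * Y) powr a i j
      \<le> matching_poly w u v S T + a i j * X * matching_poly w u v (S - {i}) T
      + a i j * Y * matching_poly w u v S (T - {j})
      + a i j * X * (a i j * Y) * matching_poly w u v (S - {i}) (T - {j})" .
  qed (simp_all add: pos)
  \<comment> \<open>The result of \<open>bethe_step\<close> is read as a change of edge weight:
    since \<open>e\<close> is not in \<open>E\<close>, \<open>w i j = 0\<close>, and adding
    \<open>a i j\<close> makes \<open>e\<close> a dimer of the right weight.\<close>
  also have "\<dots> = matching_poly (\<lambda>k l. if k = i \<and> l = j then w i j + a i j else w k l) u v S T"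
    using fin e by (simp add: matching_poly_weight_update)
  also have "(\<lambda>k l. if k = i \<and> l = j then w i j + a i j else w k l)
    = (\<lambda>k l. if (k,l) \<in> ?E then a k l else 0)"
    using insert.hyps e by (auto simp: w_def fun_eq_iff)
  also have "K * pow0 (1 - a i j) (1 - a i j)
    = (\<Prod>e\<in>S \<times> T - ?E. (x e * y e) powr case_prod a e)
      * (\<Prod>(i,j)\<in>?E. pow0 (1 - a i j) (1 - a i j))"
    using insert.hyps e by (simp add: K_def)
  finally show ?case unfolding u_def v_def .
qed

text \<open>Once every edge is eliminated, all monomer weights equal \<open>\<epsilon>\<close>. The
  partition function is a polynomial in \<open>\<epsilon>\<close>, so the bound passes to the limit
  as \<open>\<epsilon>\<close> tends to 0 from the right, where the right side is the permanent of
  \<open>a\<close>.\<close>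

theorem bethe_permanent_bound:
  fixes a :: "'a \<Rightarrow> 'b \<Rightarrow> real"
  assumes fin: "finite S" "finite T"
    and a: "\<And>i j. i \<in> S \<Longrightarrow> j \<in> T \<Longrightarrow> 0 \<le> a i j"
    and row: "\<And>i. i \<in> S \<Longrightarrow> (\<Sum>j\<in>T. a i j) = 1"
    and col: "\<And>j. j \<in> T \<Longrightarrow> (\<Sum>i\<in>S. a i j) = 1"
  shows "(\<Prod>(i,j)\<in>S \<times> T. pow0 (1 - a i j) (1 - a i j))
    \<le> matching_poly a (\<lambda>i. 0) (\<lambda>j. 0) S T"
proof (rule tendsto_lowerbound)
  have "isCont (\<lambda>\<epsilon>. matching_poly a (\<lambda>i. \<epsilon>) (\<lambda>j. \<epsilon>) S T) 0"
    unfolding matching_poly_def by (intro continuous_intros)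
  then show "((\<lambda>\<epsilon>. matching_poly a (\<lambda>i. \<epsilon>) (\<lambda>j. \<epsilon>) S T) \<longlongrightarrow> matching_poly a (\<lambda>i. 0) (\<lambda>j. 0) S T) (at_right 0)"
    by (simp add: isCont_def filterlim_at_split)
  have "(\<Prod>(i,j)\<in>S \<times> T. pow0 (1 - a i j) (1 - a i j)) \<le> matching_poly a (\<lambda>i. \<epsilon>) (\<lambda>j. \<epsilon>) S T"
    if "0 < \<epsilon>" for \<epsilon>
  proof -
    have "(\<Prod>(i,j)\<in>S \<times> T. pow0 (1 - a i j) (1 - a i j))
      \<le> matching_poly (\<lambda>i j. if (i,j) \<in> S \<times> T then a i j else 0)
        (\<lambda>i. \<epsilon> + (\<Sum>j\<in>T. if (i,j) \<in> S \<times> T then 0 else a i j * 1))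
        (\<lambda>j. \<epsilon> + (\<Sum>i\<in>S. if (i,j) \<in> S \<times> T then 0 else a i j * 1)) S T"
      using matching_poly_bethe_partial[OF fin a row col that, of "S \<times> T" "\<lambda>e. 1" "\<lambda>e. 1"] fin by simp
    also have "\<dots> = matching_poly a (\<lambda>i. \<epsilon>) (\<lambda>j. \<epsilon>) S T"
      by (rule matching_poly_cong) auto
    finally show ?thesis .
  qed
  then show "\<forall>\<^sub>F \<epsilon> in at_right 0. (\<Prod>(i,j)\<in>S \<times> T. pow0 (1 - a i j) (1 - a i j))
      \<le> matching_poly a (\<lambda>i. \<epsilon>) (\<lambda>j. \<epsilon>) S T"
    unfolding eventually_at_right_field by (intro exI[of _ 1]) simp
qed simp

subsection \<open>Permanents of bordered matrices\<close>

text \<open>Zero monomer weights annihilate every matching that misses a vertex; the remaining ones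
  are the graphs of the bijections from \<open>S\<close> to \<open>T\<close>.\<close>

lemma per_sub_eq_matching_poly:
  fixes A :: "nat \<Rightarrow> nat \<Rightarrow> nat"
  assumes fin: "finite S" "finite T"
  shows "matching_poly (\<lambda>i j. real (A i j)) (\<lambda>i. 0) (\<lambda>j. 0) S T = real (per_sub A S T)"
proof -
  let ?P = "{M \<in> matchings S T. fst ` M = S \<and> snd ` M = T}"
  let ?F = "{f \<in> S \<rightarrow>\<^sub>E T. bij_betw f S T}"
  have "matching_poly (\<lambda>i j. real (A i j)) (\<lambda>i. 0) (\<lambda>j. 0) S T = (\<Sum>M\<in>?P. \<Prod>(i,j)\<in>M. real (A i j))"
    unfolding matching_poly_def
  proof (rule sum.mono_neutral_cong_right)
    show "finite (matchings S T)" using fin by (rule finite_matchings)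
    show "\<forall>M\<in>matchings S T - ?P. (\<Prod>(i,j)\<in>M. real (A i j))
      * (\<Prod>i\<in>S - fst ` M. 0) * (\<Prod>j\<in>T - snd ` M. 0) = 0"
    proof
      fix M assume M: "M \<in> matchings S T - ?P"
      then have "fst ` M \<subseteq> S" "snd ` M \<subseteq> T" by (auto simp: matchings_def)
      then have "S - fst ` M \<noteq> {} \<or> T - snd ` M \<noteq> {}" using M by auto
      then show "(\<Prod>(i,j)\<in>M. real (A i j))
        * (\<Prod>i\<in>S - fst ` M. 0) * (\<Prod>j\<in>T - snd ` M. 0) = 0"
        using fin by auto
    qed
    fix M assume "M \<in> ?P"
    then have "S - fst ` M = {}" "T - snd ` M = {}" by simp_all
    then show "(\<Prod>(i,j)\<in>M. real (A i j)) * (\<Prod>i\<in>S - fst ` M. 0) * (\<Prod>j\<in>T - snd ` M. 0)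
      = (\<Prod>(i,j)\<in>M. real (A i j))" by (simp only: prod.empty mult_1_right)
  qed simp
  also have "\<dots> = (\<Sum>f\<in>?F. \<Prod>i\<in>S. real (A i (f i)))"
  \<comment> \<open>A bijection is exchanged for its graph. Restricting the recovered function to
    \<open>S\<close> makes it extensional, as membership in \<open>S \<rightarrow>\<^sub>E T\<close>
    requires.\<close>
  proof (rule sum.reindex_bij_witness[of _ "\<lambda>f. (\<lambda>i. (i, f i)) ` S"
        "\<lambda>M. \<lambda>i\<in>S. THE j. (i,j) \<in> M"])
    fix M assume M: "M \<in> ?P"
    define f where "f = (\<lambda>i\<in>S. THE j. (i,j) \<in> M)"
    have inj: "inj_on fst M" "inj_on snd M" and M': "M \<subseteq> S \<times> T" "fst ` M = S" "snd ` M = T"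
      using M by (auto simp: matchings_def)
    have f: "f i = j" if "(i,j) \<in> M" for i j
    proof -
      have "(THE l. (i,l) \<in> M) = j"
      proof (rule the_equality)
        show "(i,j) \<in> M" by (rule that)
        show "l = j" if "(i,l) \<in> M" for l
          using inj_onD[OF inj(1) _ that \<open>(i,j) \<in> M\<close>] by simp
      qed
      then show ?thesis using that M' by (auto simp: f_def)
    qed
    have mem: "(i, f i) \<in> M" if i: "i \<in> S" for i
    proof -
      have "i \<in> fst ` M" using i M' by simp
      then obtain j where "(i,j) \<in> M" by auto
      then show ?thesis using f by metis
    qed
    have graph: "(\<lambda>i. (i, f i)) ` S = M"
    proof
      show "(\<lambda>i. (i, f i)) ` S \<subseteq> M" using mem by auto
      show "M \<subseteq> (\<lambda>i. (i, f i)) ` S"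
      proof
        fix p assume p: "p \<in> M"
        then have "p = (fst p, f (fst p))" "fst p \<in> S"
          using f[of "fst p" "snd p"] M'(2) by auto
        then show "p \<in> (\<lambda>i. (i, f i)) ` S" by (rule image_eqI)
      qed
    qed
    show "(\<lambda>i. (i, (\<lambda>i\<in>S. THE j. (i,j) \<in> M) i)) ` S = M"
      using graph by (simp only: f_def)
    have "inj_on f S"
    proof (rule inj_onI)
      fix i k assume "i \<in> S" "k \<in> S" "f i = f k"
      then show "i = k" using inj_onD[OF inj(2) _ mem[of i] mem[of k]] by simp
    qed
    moreover have "f ` S = T"
    proof -
      have "f ` S = snd ` (\<lambda>i. (i, f i)) ` S" by (simp add: image_image)
      then show ?thesis using graph M' by simp
    qed
    ultimately have "bij_betw f S T" by (simp add: bij_betw_def)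
    moreover have "f \<in> S \<rightarrow>\<^sub>E T" using \<open>f ` S = T\<close> by (auto simp: f_def)
    ultimately show "(\<lambda>i\<in>S. THE j. (i,j) \<in> M) \<in> ?F" by (simp add: f_def)
    have "(\<Prod>(i,j)\<in>M. real (A i j)) = (\<Prod>(i,j)\<in>(\<lambda>i. (i, f i)) ` S. real (A i j))"
      by (simp only: graph)
    also have "\<dots> = (\<Prod>i\<in>S. real (A i (f i)))"
      by (subst prod.reindex) (auto simp: inj_on_def)
    finally show "(\<Prod>i\<in>S. real (A i ((\<lambda>i\<in>S. THE j. (i,j) \<in> M) i)))
      = (\<Prod>(i,j)\<in>M. real (A i j))" by (simp only: f_def)
  next
    fix f assume f: "f \<in> ?F"
    let ?M = "(\<lambda>i. (i, f i)) ` S"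
    show "(\<lambda>i\<in>S. THE j. (i,j) \<in> ?M) = f"
    proof
      fix i
      show "(\<lambda>i\<in>S. THE j. (i,j) \<in> ?M) i = f i"
        using f by (cases "i \<in> S") (auto simp: PiE_def extensional_def)
    qed
    have "inj_on f S" "f ` S = T" using f by (auto simp: bij_betw_def)
    then have "?M \<subseteq> S \<times> T" "inj_on fst ?M" "inj_on snd ?M"
      by (auto simp: inj_on_def)
    moreover have "fst ` ?M = S" "snd ` ?M = T"
      using \<open>f ` S = T\<close> by (simp_all add: image_image)
    ultimately show "?M \<in> ?P" by (simp add: matchings_def)
  qed
  finally show ?thesis by (simp add: per_sub_def)
qed

text \<open>With zero row monomer weights every contributing matching has exactly
  \<open>card S\<close> dimers, and each carries one factor \<open>c\<close>.\<close>

lemma matching_poly_scale: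
  assumes "finite S" "finite T"
  shows "matching_poly (\<lambda>i j. c * a i j) (\<lambda>i. 0) v S T = c ^ card S * matching_poly a (\<lambda>i. 0) v S T"
  using assms
proof (induction S arbitrary: T rule: finite_induct)
  case empty
  then show ?case by (simp add: matching_poly_no_rows)
next
  case (insert i S)
  then show ?case
    by (simp add: matching_poly_row[of "insert i S" T i] sum_distrib_left algebra_simps)
qed

text \<open>Each column of \<open>X\<close> must be covered, and only rows of \<open>S\<close> can
  cover it with nonzero weight. If \<open>R\<close> is the set of rows of \<open>S\<close> left
  over, the other rows are matched to \<open>X\<close> in \<open>fact (card X)\<close> ways, each of
  weight \<open>b ^ card X\<close>. The set \<open>Y\<close> makes room for the border rows, which
  meet \<open>X\<close> in the zero corner.\<close>

lemma matching_poly_uniform_cols: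
  fixes a :: "'a \<Rightarrow> 'b \<Rightarrow> real"
  assumes "finite S" "finite Y" "S \<inter> Y = {}" "finite T" "finite X" "T \<inter> X = {}"
    and "\<And>i c. i \<in> S \<Longrightarrow> c \<in> X \<Longrightarrow> a i c = b"
    and "\<And>i c. i \<in> Y \<Longrightarrow> c \<in> X \<Longrightarrow> a i c = 0"
    and "\<And>c. c \<in> X \<Longrightarrow> v c = 0"
  shows "matching_poly a u v (S \<union> Y) (T \<union> X)
    = b ^ card X * fact (card X)
      * (\<Sum>R | R \<subseteq> S \<and> card R + card X = card S. matching_poly a u v (R \<union> Y) T)"
  using assms(5,1,3,6-9)
proof (induction X arbitrary: S rule: finite_induct)
  case empty
  have "{R. R \<subseteq> S \<and> card R = card S} = {S}"
    using card_subset_eq[OF empty(1)] by blast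
  then show ?case by simp
next
  case (insert c X)
  let ?R = "{R \<in> Pow S. card R + Suc (card X) = card S}"
  have c: "c \<notin> T" "finite (S \<union> Y)" "finite (T \<union> insert c X)"
    using insert assms by auto
  have T: "T \<union> insert c X - {c} = T \<union> X" using insert c by auto
  have "matching_poly a u v (S \<union> Y) (T \<union> insert c X)
    = (\<Sum>i\<in>S \<union> Y. a i c * matching_poly a u v (S \<union> Y - {i}) (T \<union> X))"
  proof -
    have "v c = 0" using insert.prems(6) by simp
    then show ?thesis using matching_poly_col[OF c(2,3), of c a u v] unfolding T by simp
  qed
  also have "\<dots> = (\<Sum>i\<in>S. b * matching_poly a u v ((S - {i}) \<union> Y) (T \<union> X))"
  proof (rule sum.mono_neutral_cong_right)
    fix i assume "i \<in> S"
    then have "S \<union> Y - {i} = (S - {i}) \<union> Y" using insert.prems by auto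
    then show "a i c * matching_poly a u v (S \<union> Y - {i}) (T \<union> X)
      = b * matching_poly a u v ((S - {i}) \<union> Y) (T \<union> X)"
      using \<open>i \<in> S\<close> insert.prems by simp
  qed (use c insert.prems in auto)
  also have "\<dots> = (\<Sum>i\<in>S. b * (b ^ card X * fact (card X)
      * (\<Sum>R | R \<in> ?R \<and> i \<notin> R. matching_poly a u v (R \<union> Y) T)))"
  proof (rule sum.cong[OF refl])
    fix i assume i: "i \<in> S"
    have "card S = Suc (card (S - {i}))"
      using i insert.prems(1) by (simp add: card_Suc_Diff1 del: card_Diff_insert)
    then have "{R. R \<subseteq> S - {i} \<and> card R + card X = card (S - {i})} = {R. R \<in> ?R \<and> i \<notin> R}"
      by (simp only: Pow_iff mem_Collect_eq add_Suc_right nat.inject) blast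
    moreover have "matching_poly a u v ((S - {i}) \<union> Y) (T \<union> X) = b ^ card X * fact (card X)
      * (\<Sum>R | R \<subseteq> S - {i} \<and> card R + card X = card (S - {i}). matching_poly a u v (R \<union> Y) T)"
      using insert.prems by (intro insert.IH) auto
    ultimately show "b * matching_poly a u v ((S - {i}) \<union> Y) (T \<union> X)
      = b * (b ^ card X * fact (card X)
      * (\<Sum>R | R \<in> ?R \<and> i \<notin> R. matching_poly a u v (R \<union> Y) T))" by simp
  qed
  also have "\<dots> = b ^ Suc (card X) * fact (card X)
      * (\<Sum>i\<in>S. \<Sum>R | R \<in> ?R \<and> i \<notin> R. matching_poly a u v (R \<union> Y) T)"
    by (simp add: sum_distrib_left algebra_simps)
  \<comment> \<open>Double counting: a given \<open>R\<close> arises once for each row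
    \<open>i\<close> of \<open>S - R\<close> that can cover the column \<open>c\<close>. There are
    \<open>Suc (card X)\<close> such rows, which supplies the next factor of the factorial.\<close>
  also have "(\<Sum>i\<in>S. \<Sum>R | R \<in> ?R \<and> i \<notin> R. matching_poly a u v (R \<union> Y) T)
    = (\<Sum>R\<in>?R. \<Sum>i | i \<in> S \<and> i \<notin> R. matching_poly a u v (R \<union> Y) T)"
    using insert.prems by (intro sum.swap_restrict) auto
  also have "\<dots> = (\<Sum>R\<in>?R. real (Suc (card X)) * matching_poly a u v (R \<union> Y) T)"
  proof (rule sum.cong[OF refl])
    fix R assume R: "R \<in> ?R"
    have "{i. i \<in> S \<and> i \<notin> R} = S - R" by auto
    moreover have "card (S - R) = Suc (card X)"
      using R insert.prems by (auto simp: card_Diff_subset finite_subset)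
    ultimately show "(\<Sum>i | i \<in> S \<and> i \<notin> R. matching_poly a u v (R \<union> Y) T)
      = real (Suc (card X)) * matching_poly a u v (R \<union> Y) T" by simp
  qed
  also have "\<dots> = real (Suc (card X)) * (\<Sum>R\<in>?R. matching_poly a u v (R \<union> Y) T)"
    by (simp only: sum_distrib_left)
  finally have "matching_poly a u v (S \<union> Y) (T \<union> insert c X)
    = b ^ Suc (card X) * fact (Suc (card X)) * (\<Sum>R\<in>?R. matching_poly a u v (R \<union> Y) T)"
    by (simp only: fact_Suc mult_ac)
  moreover have "card (insert c X) = Suc (card X)" using insert.hyps by simp
  ultimately show ?case by simp
qed

lemma matching_poly_uniform_rows:
  fixes a :: "'a \<Rightarrow> 'b \<Rightarrow> real"
  assumes "finite S" "finite T" "finite Y" "S \<inter> Y = {}"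
    and "\<And>c j. c \<in> Y \<Longrightarrow> j \<in> T \<Longrightarrow> a c j = b"
    and "\<And>c. c \<in> Y \<Longrightarrow> u c = 0"
  shows "matching_poly a u v (S \<union> Y) T
    = b ^ card Y * fact (card Y)
      * (\<Sum>Q | Q \<subseteq> T \<and> card Q + card Y = card T. matching_poly a u v S Q)"
  using matching_poly_uniform_cols[of T "{}" S Y "\<lambda>j i. a i j" b u v] assms
  by (simp flip: matching_poly_transpose[of a u v])

section \<open>Real powers with \<open>0^0 = 1\<close>, and the absorption of multiple
  entries\<close>

lemma pow0_power:
  assumes "0 \<le> x"
  shows "pow0 x (y * real N) = pow0 x y ^ N"
proof (cases "x = 0")
  case False
  then have "0 < x powr y" using assms by simp
  then show ?thesis using False by (simp add: pow0_def powr_realpow flip: powr_powr)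
qed (auto simp: pow0_def)

text \<open>Replaces an entry \<open>c * \<alpha>\<close> by \<open>c\<close> separate entries
  \<open>\<alpha>\<close>, so that the Bethe product can be bounded through the row sums alone.
  After taking logarithms it follows from two applications of
  \<open>ln x \<le> x - 1\<close>.\<close>

lemma bethe_factor_superadditive:
  assumes "0 \<le> \<alpha>" "\<alpha> \<le> 1" "real c * \<alpha> \<le> 1"
  shows "pow0 (1 - \<alpha>) (1 - \<alpha>) ^ c \<le> pow0 (1 - real c * \<alpha>) (1 - real c * \<alpha>)"
proof -
  consider "c = 0" | "real c * \<alpha> = 1" | "1 \<le> c" "real c * \<alpha> < 1"
    using assms(3) by linarith
  then show ?thesis
  proof cases
    case 1
    then show ?thesis by (simp add: pow0_def)
  next
    \<comment> \<open>The right side is \<open>0^0 = 1\<close>, and the base on the left lies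
      between 0 and 1.\<close>
    case 2
    have "pow0 (1 - \<alpha>) (1 - \<alpha>) \<le> 1" "0 \<le> pow0 (1 - \<alpha>) (1 - \<alpha>)"
      using assms by (auto simp: pow0_def powr_le1)
    then show ?thesis using 2 by (simp add: pow0_def power_le_one)
  next
    case 3
    define s z where "s = 1 - \<alpha>" and "z = 1 - real c * \<alpha>"
    have "\<alpha> \<le> real c * \<alpha>" using 3 assms by (simp add: mult_le_cancel_right1)
    then have sz: "0 < s" "0 < z" using 3 by (auto simp: s_def z_def)
    have "ln (s / z) \<le> s / z - 1" using sz by (intro ln_le_minus_one) auto
    then have "z * (ln s - ln z) \<le> z * (s / z - 1)"
      using sz by (intro mult_left_mono) (auto simp: ln_div)
    then have "z * ln s + z - s \<le> z * ln z" using sz by (simp add: algebra_simps)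
    \<comment> \<open>The two estimates fit together because
      \<open>real c * s - z = real c - 1\<close> and
      \<open>z - s = (real c - 1) * (s - 1)\<close>.\<close>
    moreover have "(real c - 1) * ln s \<le> (real c - 1) * (s - 1)"
      using sz 3 by (intro mult_left_mono ln_le_minus_one) auto
    then have "real c * s * ln s \<le> z * ln s + z - s"
      by (simp add: s_def z_def algebra_simps)
    ultimately have "exp (real c * (s * ln s)) \<le> exp (z * ln z)" by simp
    then show ?thesis using sz
      by (simp add: pow0_def powr_def exp_of_nat_mult flip: s_def z_def)
  qed
qed

section \<open>The bordered matrix and the final estimate\<close>

theorem theorem6p2:
  fixes r n m :: nat and A :: "nat \<Rightarrow> nat \<Rightarrow> nat"
  assumes "0 < r" and "0 < n" and "RI r n A" and "0 < m" and "m \<le> n"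
  shows "real (per_m n m A) \<ge> SF r n m"
proof -
  define k where "k = n - m"
  define t \<alpha> \<beta> where "t = real m / real n" and "\<alpha> = t / real r" and "\<beta> = 1 / real n"
  define g where "g x = pow0 (1 - x) (1 - x)" for x
  define N X where "N = {..<n}" and "X = {n..<n + k}"
  define B where "B i j = (if i < n \<and> j < n then \<alpha> * real (A i j)
    else if i < n \<or> j < n then \<beta> else 0)" for i j :: nat
  have k: "real m + real k = real n" using assms(5) by (simp add: k_def)
  have rowA: "(\<Sum>j<n. A i j) = r" if "i < n" for i using assms(3) that by (simp add: RI_def)
  have colA: "(\<Sum>i<n. A i j) = r" if "j < n" for j using assms(3) that by (simp add: RI_def)
  have pos: "0 < \<alpha>" "0 < \<beta>" "0 < t" "t \<le> 1" "\<beta> \<le> 1"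
    using assms by (auto simp: t_def \<alpha>_def \<beta>_def)
  have \<alpha>t: "\<alpha> * real r = t" using assms by (simp add: \<alpha>_def)
  have "\<alpha> * 1 \<le> \<alpha> * real r" using pos assms by (intro mult_left_mono) auto
  then have \<alpha>1: "\<alpha> \<le> 1" using \<alpha>t pos by simp
  have N: "finite N" "card N = n" "finite X" "card X = k" "N \<inter> X = {}"
    by (auto simp: N_def X_def)
  \<comment> \<open>The sum of a row or column of \<open>B\<close> with index below
    \<open>n\<close>: the scaled matrix contributes \<open>\<alpha> * r = t\<close>, the border
    \<open>k\<close> entries \<beta>. A border line consists of \<open>n\<close> entries \<beta> and
    zeros.\<close>
  have tk: "t + real k * \<beta> = 1"
    using k assms by (simp add: t_def \<beta>_def field_simps)
  have rowB: "(\<Sum>j\<in>N \<union> X. B i j) = 1" if "i \<in> N \<union> X" for i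
  proof -
    have "(\<Sum>j\<in>N \<union> X. B i j) = (\<Sum>j\<in>N. B i j) + (\<Sum>j\<in>X. B i j)"
      using N by (intro sum.union_disjoint) auto
    also have "\<dots> = 1"
    proof (cases "i < n")
      case True
      then have "(\<Sum>j\<in>N. B i j) = \<alpha> * real (\<Sum>j<n. A i j)" "(\<Sum>j\<in>X. B i j) = real k * \<beta>"
        using N by (auto simp: B_def N_def X_def sum_distrib_left)
      then show ?thesis using rowA[OF True] \<alpha>t tk by simp
    next
      case False
      then have "(\<Sum>j\<in>N. B i j) = real n * \<beta>" "(\<Sum>j\<in>X. B i j) = 0"
        using N by (auto simp: B_def N_def X_def)
      then show ?thesis using assms by (simp add: \<beta>_def)
    qed
    finally show ?thesis .
  qed
  have colB: "(\<Sum>i\<in>N \<union> X. B i j) = 1" if "j \<in> N \<union> X" for j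
  proof -
    have "(\<Sum>i\<in>N \<union> X. B i j) = (\<Sum>i\<in>N. B i j) + (\<Sum>i\<in>X. B i j)"
      using N by (intro sum.union_disjoint) auto
    also have "\<dots> = 1"
    proof (cases "j < n")
      case True
      then have "(\<Sum>i\<in>N. B i j) = \<alpha> * real (\<Sum>i<n. A i j)" "(\<Sum>i\<in>X. B i j) = real k * \<beta>"
        using N by (auto simp: B_def N_def X_def sum_distrib_left)
      then show ?thesis using colA[OF True] \<alpha>t tk by simp
    next
      case False
      then have "(\<Sum>i\<in>N. B i j) = real n * \<beta>" "(\<Sum>i\<in>X. B i j) = 0"
        using N by (auto simp: B_def N_def X_def)
      then show ?thesis using assms by (simp add: \<beta>_def)
    qed
    finally show ?thesis .
  qed
  \<comment> \<open>First the border columns are expanded, which selects \<open>m\<close> rows of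
    \<open>N\<close>, then the border rows, which selects \<open>m\<close> columns. Each pass
    contributes \<open>\<beta> ^ k * fact k\<close>.\<close>
  have perB: "matching_poly B (\<lambda>i. 0) (\<lambda>j. 0) (N \<union> X) (N \<union> X)
    = \<beta> ^ (2 * k) * (fact k)\<^sup>2 * \<alpha> ^ m * real (per_m n m A)"
  proof -
    let ?R = "{R. R \<subseteq> N \<and> card R = m}"
    have R: "{R. R \<subseteq> N \<and> card R + card X = card N} = ?R"
      using N assms by (auto simp: k_def)
    have "matching_poly B (\<lambda>i. 0) (\<lambda>j. 0) (N \<union> X) (N \<union> X)
      = \<beta> ^ k * fact k * (\<Sum>S\<in>?R. matching_poly B (\<lambda>i. 0) (\<lambda>j. 0) (S \<union> X) N)"
      unfolding R[symmetric] N(4)[symmetric]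
      by (rule matching_poly_uniform_cols) (use N in \<open>auto simp: B_def N_def X_def\<close>)
    also have "(\<Sum>S\<in>?R. matching_poly B (\<lambda>i. 0) (\<lambda>j. 0) (S \<union> X) N)
      = (\<Sum>S\<in>?R. \<beta> ^ k * fact k * (\<Sum>T\<in>?R. matching_poly B (\<lambda>i. 0) (\<lambda>j. 0) S T))"
    proof (rule sum.cong[OF refl])
      fix S assume "S \<in> ?R"
      then show "matching_poly B (\<lambda>i. 0) (\<lambda>j. 0) (S \<union> X) N
        = \<beta> ^ k * fact k * (\<Sum>T\<in>?R. matching_poly B (\<lambda>i. 0) (\<lambda>j. 0) S T)"
        unfolding R[symmetric] N(4)[symmetric]
        by (intro matching_poly_uniform_rows) (use N in \<open>auto simp: B_def N_def X_def finite_subset\<close>)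
    qed
    also have "\<dots> = (\<Sum>S\<in>?R. \<beta> ^ k * fact k * (\<Sum>T\<in>?R. \<alpha> ^ m * real (per_sub A S T)))"
    proof (intro sum.cong refl arg_cong2[of _ _ _ _ "(*)"])
      fix S T assume ST: "S \<in> ?R" "T \<in> ?R"
      then have fin: "finite S" "finite T" using N finite_subset by auto
      have "matching_poly B (\<lambda>i. 0) (\<lambda>j. 0) S T = matching_poly (\<lambda>i j. \<alpha> * real (A i j)) (\<lambda>i. 0) (\<lambda>j. 0) S T"
        using ST by (intro matching_poly_cong) (auto simp: B_def N_def)
      also have "\<dots> = \<alpha> ^ m * real (per_sub A S T)"
        using ST fin by (simp add: matching_poly_scale per_sub_eq_matching_poly)
      finally show "matching_poly B (\<lambda>i. 0) (\<lambda>j. 0) S T = \<alpha> ^ m * real (per_sub A S T)" .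
    qed
    also have "\<dots> = \<beta> ^ k * fact k * \<alpha> ^ m * real (per_m n m A)"
      by (simp add: per_m_def N_def sum_distrib_left algebra_simps)
    finally show ?thesis
      unfolding power2_eq_square mult_2 power_add by (simp only: mult_ac)
  qed
  \<comment> \<open>There are \<open>2 * n * k\<close> border entries equal to \<beta>; the zero
    corner contributes only factors \<open>g 0 = 1\<close>.\<close>
  have betheB: "(\<Prod>(i,j)\<in>(N \<union> X) \<times> (N \<union> X). g (B i j))
    = (\<Prod>i<n. \<Prod>j<n. g (\<alpha> * real (A i j))) * g \<beta> ^ (2 * n * k)"
  proof -
    have "(\<Prod>(i,j)\<in>(N \<union> X) \<times> (N \<union> X). g (B i j)) = (\<Prod>i\<in>N \<union> X. \<Prod>j\<in>N \<union> X. g (B i j))"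
      by (simp add: prod.cartesian_product)
    also have "\<dots> = (\<Prod>i\<in>N. (\<Prod>j\<in>N. g (B i j)) * (\<Prod>j\<in>X. g (B i j)))
      * (\<Prod>i\<in>X. (\<Prod>j\<in>N. g (B i j)) * (\<Prod>j\<in>X. g (B i j)))"
      using N by (simp add: prod.union_disjoint)
    also have "(\<Prod>i\<in>N. (\<Prod>j\<in>N. g (B i j)) * (\<Prod>j\<in>X. g (B i j)))
      = (\<Prod>i<n. (\<Prod>j<n. g (\<alpha> * real (A i j))) * g \<beta> ^ k)"
      unfolding N_def
    proof (intro prod.cong refl arg_cong2[of _ _ _ _ "(*)"])
      fix i assume "i \<in> {..<n}"
      then have "(\<Prod>j\<in>X. g (B i j)) = (\<Prod>j\<in>X. g \<beta>)"
        by (intro prod.cong) (auto simp: B_def X_def)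
      then show "(\<Prod>j\<in>X. g (B i j)) = g \<beta> ^ k" using N by simp
    qed (auto simp: B_def)
    also have "(\<Prod>i\<in>X. (\<Prod>j\<in>N. g (B i j)) * (\<Prod>j\<in>X. g (B i j))) = (\<Prod>i\<in>X. g \<beta> ^ n)"
    proof (rule prod.cong[OF refl])
      fix i assume "i \<in> X"
      then have "(\<Prod>j\<in>N. g (B i j)) = (\<Prod>j\<in>N. g \<beta>)" "(\<Prod>j\<in>X. g (B i j)) = (\<Prod>j\<in>X. 1)"
        by (auto simp: B_def X_def N_def g_def pow0_def intro!: prod.cong)
      then show "(\<Prod>j\<in>N. g (B i j)) * (\<Prod>j\<in>X. g (B i j)) = g \<beta> ^ n" using N by simp
    qed
    also have "\<dots> = g \<beta> ^ (n * k)" using N by (simp add: power_mult)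
    also have "(\<Prod>i<n. (\<Prod>j<n. g (\<alpha> * real (A i j))) * g \<beta> ^ k)
      = (\<Prod>i<n. \<Prod>j<n. g (\<alpha> * real (A i j))) * g \<beta> ^ (n * k)"
      by (simp add: prod.distrib power_mult mult.commute[of n])
    finally show ?thesis by (simp add: mult_2 distrib_right power_add)
  qed
  have g0: "0 \<le> g x" for x by (simp add: g_def pow0_def)
  \<comment> \<open>The entries of \<open>A\<close> add up to \<open>n * r\<close>, so the exponents
    can be distributed over the entries and superadditivity applied to each. Its condition holds
    since \<open>A i j \<le> r\<close> and \<open>r * \<alpha> = t \<le> 1\<close>.\<close>
  have "g \<alpha> ^ (n * r) = (\<Prod>i<n. \<Prod>j<n. g \<alpha> ^ A i j)"
    using rowA by (simp flip: power_sum) (simp add: mult.commute flip: power_mult)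
  also have "\<dots> \<le> (\<Prod>i<n. \<Prod>j<n. g (\<alpha> * real (A i j)))"
  proof (intro prod_mono conjI prod_nonneg)
    fix i j assume ij: "i \<in> {..<n}" "j \<in> {..<n}"
    have "A i j \<le> (\<Sum>j<n. A i j)" using ij by (intro member_le_sum) auto
    then have "A i j \<le> r" using rowA ij by simp
    then have "real (A i j) * \<alpha> \<le> real r * \<alpha>" using pos by (intro mult_right_mono) auto
    also have "\<dots> \<le> 1" using \<alpha>t pos by (simp add: mult.commute)
    finally show "g \<alpha> ^ A i j \<le> g (\<alpha> * real (A i j))"
      using bethe_factor_superadditive[of \<alpha> "A i j"] pos \<alpha>1 by (simp add: g_def mult.commute)
  qed (simp_all add: g0)
  finally have "g \<alpha> ^ (n * r) * g \<beta> ^ (2 * n * k)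
    \<le> (\<Prod>i<n. \<Prod>j<n. g (\<alpha> * real (A i j))) * g \<beta> ^ (2 * n * k)"
    using g0 by (intro mult_right_mono) auto
  also have "\<dots> \<le> matching_poly B (\<lambda>i. 0) (\<lambda>j. 0) (N \<union> X) (N \<union> X)"
    unfolding betheB[symmetric] unfolding g_def using N pos rowB colB
    by (intro bethe_permanent_bound) (auto simp: B_def)
  finally have main: "g \<alpha> ^ (n * r) * g \<beta> ^ (2 * n * k)
    \<le> \<alpha> ^ m * \<beta> ^ (2 * k) * (fact k)\<^sup>2 * real (per_m n m A)"
    unfolding perB by (simp add: algebra_simps)
  \<comment> \<open>From here on the factors of \<open>SF\<close> are identified one by one: these
    identities turn its real exponents into the natural exponents of \<open>main\<close>, after
    which only a division by a positive number remains.\<close>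
  have nt: "real n * t = real m" "real n * (1 - t) = real k"
    using k assms by (simp_all add: t_def right_diff_distrib)
  have "pow0 (1 - \<alpha>) ((1 - \<alpha>) * real n * real r) = g \<alpha> ^ (n * r)"
    using pow0_power[of "1 - \<alpha>" "1 - \<alpha>" "n * r"] \<alpha>1 by (simp add: g_def mult.assoc)
  moreover have "(1 - \<beta>) * 2 * (real n)\<^sup>2 * (1 - t) = (1 - \<beta>) * real (2 * n * k)"
    unfolding of_nat_mult nt(2)[symmetric] by (simp add: power2_eq_square algebra_simps)
  then have "pow0 (1 - \<beta>) ((1 - \<beta>) * 2 * (real n)\<^sup>2 * (1 - t)) = g \<beta> ^ (2 * n * k)"
    using pow0_power[of "1 - \<beta>" "1 - \<beta>" "2 * n * k"] pos by (simp add: g_def)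
  moreover have "pow0 \<alpha> (real n * t) = \<alpha> ^ m"
    using pos by (simp add: nt pow0_def powr_realpow)
  moreover have "pow0 (real n) (- 2 * real n * (1 - t)) = \<beta> ^ (2 * k)"
  proof -
    have "- 2 * real n * (1 - t) = - real (2 * k)" using nt by simp
    then have "pow0 (real n) (- 2 * real n * (1 - t)) = real n powr (- real (2 * k))"
      using assms by (simp only: pow0_def) simp
    also have "\<dots> = 1 / real n ^ (2 * k)"
      using assms by (simp only: powr_minus powr_realpow of_nat_0_less_iff) (simp add: field_simps)
    finally show ?thesis by (simp add: \<beta>_def power_one_over)
  qed
  ultimately have "SF r n m
    = g \<alpha> ^ (n * r) * g \<beta> ^ (2 * n * k) / (\<alpha> ^ m * \<beta> ^ (2 * k) * (fact k)\<^sup>2)"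
    by (simp add: SF_def Let_def k_def flip: t_def \<alpha>_def \<beta>_def)
  also have "\<dots> \<le> real (per_m n m A)"
    using main pos by (simp add: divide_le_eq mult_ac)
  finally show ?thesis .
qed

end
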